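(* Up to isomorphism, the only $1$-dimensional obstruction to shellability is the simplicial complex on four distinct vertices $a,b,c,d$ whose facets are $\{a,b\}$ and $\{c,d\}$.
   Context: All simplicial complexes are finite (abstract) and contain the empty face; if $K$ is a simplicial complex on vertex set $V$, then $\{v\}\in K$ for every $v\in V$. Facets are the inclusion-maximal faces; $\dim F=|F|-1$. A complex is pure if all its facets have the same dimension. For $U\subseteq V$, the induced subcomplex $K(U)$ is $\{F\in K: F\subseteq U\}$; it is proper if $U\subsetneq V$. Shellability means (not necessarily pure) shellability: $K$ is shellable if its facets can be ordered $F_1,\dots,F_t$ so that for each $k=2,\dots,t$ the complex $\left(\bigcup_{i=1}^{k-1}\bar F_i\right)\cap \bar F_k$ is pure of dimension $\dim F_k-1$, where $\bar F$ denotes the simplex consisting of all subsets of $F$. An obstruction to shellability is a nonshellable simplicial complex all of whose proper induced subcomplexes are shellable. *)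

theory Defs
  imports Main
begin

definition simplicial_complex :: "'a set \<Rightarrow> 'a set set \<Rightarrow> bool" where
  "simplicial_complex V K \<longleftrightarrow>
     finite V \<and> {} \<in> K \<and> K \<subseteq> Pow V \<and>
     (\<forall>v\<in>V. {v} \<in> K) \<and>
     (\<forall>F\<in>K. \<forall>G. G \<subseteq> F \<longrightarrow> G \<in> K)"

definition facets :: "'a set set \<Rightarrow> 'a set set" where
  "facets K = {F \<in> K. \<forall>G\<in>K. F \<subseteq> G \<longrightarrow> G = F}"

(* Integer-valued, so that the empty face has dimension -1. *)
definition face_dim :: "'a set \<Rightarrow> int" where
  "face_dim F = int (card F) - 1"

definition complex_dim :: "'a set set \<Rightarrow> int" where
  "complex_dim K = Max (face_dim ` K)"

definition pure_complex :: "'a set set \<Rightarrow> bool" where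
  "pure_complex K \<longleftrightarrow> (\<forall>F\<in>facets K. \<forall>G\<in>facets K. face_dim F = face_dim G)"

definition induced :: "'a set set \<Rightarrow> 'a set \<Rightarrow> 'a set set" where
  "induced K U = {F \<in> K. F \<subseteq> U}"

(* Pow F is the simplex of all subsets of F; list positions count from 0, so the
   condition starts at the second facet. *)
definition shelling :: "'a set set \<Rightarrow> 'a set list \<Rightarrow> bool" where
  "shelling K Fs \<longleftrightarrow>
     distinct Fs \<and> set Fs = facets K \<and>
     (\<forall>k. 0 < k \<and> k < length Fs \<longrightarrow>
        (let L = (\<Union>i<k. Pow (Fs ! i)) \<inter> Pow (Fs ! k)
         in pure_complex L \<and> complex_dim L = face_dim (Fs ! k) - 1))"

definition shellable :: "'a set set \<Rightarrow> bool" where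
  "shellable K \<longleftrightarrow> (\<exists>Fs. shelling K Fs)"

definition shellability_obstruction :: "'a set \<Rightarrow> 'a set set \<Rightarrow> bool" where
  "shellability_obstruction V K \<longleftrightarrow>
     simplicial_complex V K \<and> \<not> shellable K \<and> (\<forall>U. U \<subset> V \<longrightarrow> shellable (induced K U))"

definition complex_iso :: "'a set \<Rightarrow> 'a set set \<Rightarrow> 'b set \<Rightarrow> 'b set set \<Rightarrow> bool" where
  "complex_iso V K W L \<longleftrightarrow>
     (\<exists>f. bij_betw f V W \<and> (\<forall>F. F \<subseteq> V \<longrightarrow> (F \<in> K \<longleftrightarrow> f ` F \<in> L)))"

definition complex_with_facets :: "'a set set \<Rightarrow> 'a set set" where
  "complex_with_facets A = (\<Union>F\<in>A. Pow F)"

lemma facets_complex_with_facets: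
  assumes "\<And>F G. F \<in> A \<Longrightarrow> G \<in> A \<Longrightarrow> F \<subseteq> G \<Longrightarrow> F = G"
  shows "facets (complex_with_facets A) = A"
proof
  show "facets (complex_with_facets A) \<subseteq> A"
    unfolding facets_def complex_with_facets_def by blast
  show "A \<subseteq> facets (complex_with_facets A)"
  proof
    fix F assume F: "F \<in> A"
    have "G = F" if "H \<in> A" "G \<subseteq> H" "F \<subseteq> G" for G H
      using assms[OF F \<open>H \<in> A\<close>] that by auto
    with F show "F \<in> facets (complex_with_facets A)"
      unfolding facets_def complex_with_facets_def by auto
  qed
qed

lemma simplicial_complex_complex_with_facets:
  assumes "finite A" "A \<noteq> {}" "\<And>F. F \<in> A \<Longrightarrow> finite F"
  shows "simplicial_complex (\<Union>A) (complex_with_facets A)"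
  using assms unfolding simplicial_complex_def complex_with_facets_def by auto

lemma complex_with_facets_unique:
  assumes K: "simplicial_complex V K"
  shows "complex_with_facets (facets K) = K"
proof
  show "complex_with_facets (facets K) \<subseteq> K"
    using K unfolding simplicial_complex_def complex_with_facets_def facets_def by blast
next
  have fin: "finite K"
    using K unfolding simplicial_complex_def by (meson finite_Pow_iff finite_subset)
  show "K \<subseteq> complex_with_facets (facets K)"
  proof
    fix F assume "F \<in> K"
    with fin obtain M where "M \<in> K" "F \<subseteq> M" "\<forall>G\<in>K. M \<subseteq> G \<longrightarrow> G = M"
      using finite_has_maximal2[of K F] by metis
    then show "F \<in> complex_with_facets (facets K)"
      unfolding complex_with_facets_def facets_def by blast
  qed
qed

end

theory Submission
  imports Defs
begin

text \<open>In a complex of dimension at most one, a facet of dimension at most zero can always be added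
  last in a shelling, and an edge can be added as soon as it meets an earlier edge. So if any two
  disjoint edges are met by a common third one, the edges can be listed greedily: an edge that is
  disjoint from all listed ones is joined to the first listed edge by an edge that is not listed
  yet and can be added. Hence a nonshellable such complex contains two disjoint edges that no third
  edge joins, and these induce a nonshellable subcomplex, which for an obstruction is everything.\<close>

section \<open>Orderings in which each set meets an earlier one\<close>

text \<open>Only the intersection pattern of the members of \<open>E\<close> matters. By
  \<open>joined\<close>, disjoint members have a common neighbour in the intersection graph, so
  every linked list that does not exhaust \<open>E\<close> can be prolonged by one member; the
  induction is on the length of the list.\<close>

lemma linked_edge_ordering:
  fixes E :: "'a set set"
  assumes "finite E"
    and joined: "\<And>e f. e \<in> E \<Longrightarrow> f \<in> E \<Longrightarrow> e \<inter> f = {} \<Longrightarrow>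
                   \<exists>g\<in>E. g \<inter> e \<noteq> {} \<and> g \<inter> f \<noteq> {}"
  shows "\<exists>es. distinct es \<and> set es = E \<and>
              (\<forall>k. 0 < k \<and> k < length es \<longrightarrow> (\<exists>i<k. es ! i \<inter> es ! k \<noteq> {}))"
proof -
  let ?linked = "\<lambda>es. \<forall>k. 0 < k \<and> k < length es \<longrightarrow> (\<exists>i<k. es ! i \<inter> es ! k \<noteq> {})"
  have "\<exists>es. distinct es \<and> set es \<subseteq> E \<and> length es = n \<and> ?linked es" if "n \<le> card E" for n
    using that
  proof (induction n)
    case 0
    show ?case by (intro exI[of _ "[]"]) simp
  next
    case (Suc n)
    then obtain es where es: "distinct es" "set es \<subseteq> E" "length es = n" "?linked es"
      by auto
    have "card (set es) < card E"
      using Suc.prems es by (simp add: distinct_card)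
    then obtain f where f: "f \<in> E" "f \<notin> set es"
      using es(2) by (metis less_irrefl subsetI subset_antisym)
    have "\<exists>g\<in>E. g \<notin> set es \<and> (es \<noteq> [] \<longrightarrow> (\<exists>e\<in>set es. e \<inter> g \<noteq> {}))"
    proof (cases "es = [] \<or> (\<exists>e\<in>set es. e \<inter> f \<noteq> {})")
      case True
      with f show ?thesis by blast
    next
      case False
      then have hd: "hd es \<in> set es" and disj: "\<forall>e\<in>set es. e \<inter> f = {}" by auto
      \<comment> \<open>Meeting \<open>f\<close> keeps \<open>g\<close> out of \<open>es\<close>,
        all of whose members miss \<open>f\<close>; meeting \<open>hd es\<close> makes
        \<open>g\<close> admissible as the next entry.\<close>
      then obtain g where "g \<in> E" "g \<inter> hd es \<noteq> {}" "g \<inter> f \<noteq> {}"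
        using joined[of "hd es" f] es(2) f(1) by blast
      with hd disj show ?thesis by blast
    qed
    then obtain g where g: "g \<in> E" "g \<notin> set es" "es \<noteq> [] \<longrightarrow> (\<exists>e\<in>set es. e \<inter> g \<noteq> {})"
      by blast
    have "?linked (es @ [g])"
    proof (intro allI impI)
      fix k assume k: "0 < k \<and> k < length (es @ [g])"
      show "\<exists>i<k. (es @ [g]) ! i \<inter> (es @ [g]) ! k \<noteq> {}"
      proof (cases "k < length es")
        case True
        with k es(4) obtain i where "i < k" "es ! i \<inter> es ! k \<noteq> {}" by blast
        with True show ?thesis by (intro exI[of _ i]) (simp add: nth_append)
      next
        case False
        with k have "k = length es" "es \<noteq> []" by auto
        moreover from this g(3) obtain i where "i < length es" "es ! i \<inter> g \<noteq> {}"
          by (metis in_set_conv_nth)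
        ultimately show ?thesis by (intro exI[of _ i]) (simp add: nth_append)
      qed
    qed
    with es g show ?case by (intro exI[of _ "es @ [g]"]) simp
  qed
  then obtain es where "distinct es" "set es \<subseteq> E" "length es = card E" "?linked es"
    by blast
  moreover from this assms(1) have "set es = E"
    by (metis card_subset_eq distinct_card)
  ultimately show ?thesis by blast
qed

section \<open>Shellability in dimension at most one\<close>

lemma pure_complex_trivial: "pure_complex {{}}" "complex_dim {{}} = -1"
  by (simp_all add: pure_complex_def facets_def complex_dim_def face_dim_def)

text \<open>Members of \<open>L\<close> are proper subsets of an edge, so they have at most one
  vertex. Since \<open>{v}\<close> is among them, the empty face is not maximal, and every facet of
  \<open>L\<close> is a single vertex. This is the shelling condition for an edge that meets an
  earlier facet.\<close>

lemma pure_complex_edge_boundary: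
  assumes F: "card F = 2" and L: "L \<subseteq> Pow F" "F \<notin> L" "{v} \<in> L"
  shows "pure_complex L" "complex_dim L = 0"
proof -
  have finF: "finite F" using F card.infinite by fastforce
  have le: "card G \<le> 1" if "G \<in> L" for G
  proof -
    from that L have "G \<subset> F" by blast
    from psubset_card_mono[OF finF this] F show ?thesis by simp
  qed
  have "card G = 1" if G: "G \<in> facets L" for G
  proof -
    have "G \<in> L" and max: "\<forall>H\<in>L. G \<subseteq> H \<longrightarrow> H = G" using G unfolding facets_def by blast+
    from bspec[OF max L(3)] have "G \<noteq> {}" by auto
    have "finite G" using \<open>G \<in> L\<close> L(1) finF finite_subset by blast
    with \<open>G \<noteq> {}\<close> have "card G > 0" by (simp add: card_gt_0_iff)
    with le[OF \<open>G \<in> L\<close>] show ?thesis by linarith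
  qed
  then show "pure_complex L" by (simp add: pure_complex_def face_dim_def)
  have "finite L" using L(1) finF finite_subset by auto
  moreover have "0 \<in> face_dim ` L" using L(3) by (force simp: face_dim_def)
  ultimately show "complex_dim L = 0"
    unfolding complex_dim_def using le by (intro Max_eqI) (auto simp: face_dim_def dest: le)
qed

text \<open>The edges come first, in a linked order, and the remaining facets follow in any order. A
  later edge meets its predecessors in one or two vertices, of dimension 0; an isolated vertex meets
  them only in the empty face, of dimension -1.\<close>

lemma shellable_if_edges_joined:
  assumes K: "simplicial_complex V K" and dim: "\<And>F. F \<in> K \<Longrightarrow> card F \<le> 2"
    and joined: "\<And>e f. e \<in> K \<Longrightarrow> f \<in> K \<Longrightarrow> card e = 2 \<Longrightarrow> card f = 2 \<Longrightarrow> e \<inter> f = {} \<Longrightarrow>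
                   \<exists>g\<in>K. card g = 2 \<and> g \<inter> e \<noteq> {} \<and> g \<inter> f \<noteq> {}"
  shows "shellable K"
proof -
  define E where "E = {e \<in> K. card e = 2}"
  have finV: "finite V" and KV: "K \<subseteq> Pow V" using K by (auto simp: simplicial_complex_def)
  have finF: "finite F" if "F \<in> K" for F
    using that KV finV finite_subset by blast
  have finK: "finite K" using KV finV finite_subset by auto
  have E_facets: "E \<subseteq> facets K"
  proof
    fix e assume "e \<in> E"
    then have e: "e \<in> K" "card e = 2" by (auto simp: E_def)
    have "G = e" if "G \<in> K" "e \<subseteq> G" for G
      using card_seteq[OF finF[OF that(1)] that(2)] dim[OF that(1)] e(2) by simp
    with e(1) show "e \<in> facets K" by (auto simp: facets_def)
  qed
  have "finite E" using finK by (simp add: E_def)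
  then obtain es where es: "distinct es" "set es = E"
    and linked: "\<And>k. 0 < k \<Longrightarrow> k < length es \<Longrightarrow> \<exists>i<k. es ! i \<inter> es ! k \<noteq> {}"
  proof -
    have "\<exists>g\<in>E. g \<inter> e \<noteq> {} \<and> g \<inter> f \<noteq> {}" if "e \<in> E" "f \<in> E" "e \<inter> f = {}" for e f
      using joined[of e f] that unfolding E_def by blast
    from linked_edge_ordering[OF \<open>finite E\<close> this] that show thesis by blast
  qed
  have "finite (facets K - E)" using finK by (simp add: facets_def)
  then obtain vs where vs: "set vs = facets K - E" "distinct vs"
    using finite_distinct_list by blast
  define Fs where "Fs = es @ vs"
  have dFs: "distinct Fs" and sFs: "set Fs = facets K"
    using es vs E_facets by (auto simp: Fs_def)
  have "pure_complex L \<and> complex_dim L = face_dim (Fs ! k) - 1"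
    if k: "0 < k" "k < length Fs" and L: "L = (\<Union>i<k. Pow (Fs ! i)) \<inter> Pow (Fs ! k)" for k L
  proof -
    have fac: "Fs ! i \<in> facets K" if "i \<le> k" for i
      using that k sFs by (metis le_less_trans nth_mem)
    have FK: "Fs ! k \<in> K" using fac[of k] by (simp add: facets_def)
    \<comment> \<open>Distinct facets are incomparable, so \<open>L\<close> contains only proper
      subsets of the new facet.\<close>
    have new: "\<not> Fs ! k \<subseteq> Fs ! i" if "i < k" for i
    proof
      assume "Fs ! k \<subseteq> Fs ! i"
      then have "Fs ! i = Fs ! k"
        using fac[of k] fac[of i] that by (auto simp: facets_def)
      then show False using dFs k that by (simp add: nth_eq_iff_index_eq)
    qed
    show ?thesis
    proof (cases "k < length es")
      case True
      then obtain i where i: "i < k" "es ! i \<inter> es ! k \<noteq> {}" using linked k by blast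
      then obtain v where "v \<in> Fs ! i" "v \<in> Fs ! k"
        using True by (auto simp: Fs_def nth_append)
      with i have "{v} \<in> L" by (auto simp: L)
      moreover have card: "card (Fs ! k) = 2"
        using True es nth_mem[OF True] by (auto simp: Fs_def nth_append E_def)
      moreover have "L \<subseteq> Pow (Fs ! k)" "Fs ! k \<notin> L" using new by (auto simp: L)
      ultimately show ?thesis
        using pure_complex_edge_boundary[of "Fs ! k" L v] by (simp add: face_dim_def)
    next
      case False
      then have "Fs ! k \<in> set vs"
        using k by (auto simp: Fs_def nth_append)
      then have "card (Fs ! k) \<noteq> 2" using vs FK by (auto simp: E_def)
      \<comment> \<open>The empty face lies in \<open>Fs ! 0\<close>, so it cannot be a facet at a
        position \<open>k > 0\<close>.\<close>
      moreover have "Fs ! k \<noteq> {}" using new[of 0] k by auto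
      ultimately have "card (Fs ! k) = 1"
        using dim[OF FK] finF[OF FK] card_gt_0_iff[of "Fs ! k"] by linarith
      then obtain v where v: "Fs ! k = {v}" by (auto simp: card_1_singleton_iff)
      \<comment> \<open>\<open>{v}\<close> itself is excluded by \<open>new\<close>, and the empty
        face is present because some facet precedes position \<open>k\<close>.\<close>
      have "L = {{}}"
        using new k(1) by (auto simp: L v subset_singleton_iff)
      then show ?thesis by (simp add: pure_complex_trivial v face_dim_def)
    qed
  qed
  then show ?thesis
    unfolding shellable_def shelling_def using dFs sFs by (intro exI[of _ Fs]) (simp add: Let_def)
qed

section \<open>The complex of two disjoint edges\<close>

lemma facets_two_disjoint:
  assumes "e \<inter> f = {}" "e \<noteq> {}" "f \<noteq> {}"
  shows "facets (complex_with_facets {e, f}) = {e, f}"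
  using assms by (intro facets_complex_with_facets) auto

text \<open>In either order the second edge meets the first only in the empty face, of dimension -1,
  where a shelling requires dimension 0.\<close>

lemma not_shellable_disjoint_edges:
  assumes "card e = 2" "card f = 2" "e \<inter> f = {}"
  shows "\<not> shellable (complex_with_facets {e, f})"
proof
  assume "shellable (complex_with_facets {e, f})"
  then obtain Fs where Fs: "shelling (complex_with_facets {e, f}) Fs"
    by (auto simp: shellable_def)
  have ne: "e \<noteq> {}" "f \<noteq> {}" "e \<noteq> f" using assms by auto
  have dFs: "distinct Fs" and sFs: "set Fs = {e, f}"
    using Fs facets_two_disjoint[OF assms(3) ne(1,2)] by (auto simp: shelling_def)
  then have len: "length Fs = 2" using ne(3) distinct_card[OF dFs] by simp
  have "Fs ! 0 \<in> {e, f}" "Fs ! 1 \<in> {e, f}" "Fs ! 0 \<noteq> Fs ! 1"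
    using dFs sFs len by (auto simp: nth_eq_iff_index_eq simp flip: sFs)
  then have "Fs ! 0 \<inter> Fs ! 1 = {}" and card: "card (Fs ! 1) = 2"
    using assms by auto
  then have "(\<Union>i<1. Pow (Fs ! i)) \<inter> Pow (Fs ! 1) = {{}}" by (auto simp: lessThan_Suc)
  moreover have "complex_dim ((\<Union>i<1. Pow (Fs ! i)) \<inter> Pow (Fs ! 1)) = face_dim (Fs ! 1) - 1"
    using Fs len unfolding shelling_def Let_def by fastforce
  ultimately show False using card by (simp add: pure_complex_trivial face_dim_def)
qed

lemma simplicial_complex_induced:
  "simplicial_complex V K \<Longrightarrow> U \<subseteq> V \<Longrightarrow> simplicial_complex U (induced K U)"
  unfolding simplicial_complex_def induced_def by (auto intro: finite_subset)

text \<open>A proper subset of the vertices contains at most one of the two edges, so the joining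
  condition of \<open>shellable_if_edges_joined\<close> holds vacuously for the induced
  subcomplex.\<close>

lemma obstruction_two_disjoint_edges:
  assumes e: "card e = 2" and f: "card f = 2" and disj: "e \<inter> f = {}"
  shows "shellability_obstruction (e \<union> f) (complex_with_facets {e, f})"
    and "complex_dim (complex_with_facets {e, f}) = 1"
proof -
  let ?K = "complex_with_facets {e, f}"
  have fin: "finite e" "finite f" using e f card.infinite by fastforce+
  have K: "simplicial_complex (e \<union> f) ?K"
    using simplicial_complex_complex_with_facets[of "{e, f}"] fin by auto
  have le: "card F \<le> 2" if "F \<in> ?K" for F
    using that e f fin by (auto simp: complex_with_facets_def dest: card_mono)
  have edge: "F = e \<or> F = f" if "F \<in> ?K" "card F = 2" for F
    using that e f card_subset_eq[OF fin(1), of F] card_subset_eq[OF fin(2), of F]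
    by (auto simp: complex_with_facets_def)
  have "shellable (induced ?K U)" if U: "U \<subset> e \<union> f" for U
  proof (rule shellable_if_edges_joined)
    show "simplicial_complex U (induced ?K U)"
      using U K by (intro simplicial_complex_induced) auto
    show "card F \<le> 2" if "F \<in> induced ?K U" for F
      using that le by (simp add: induced_def)
    fix g h assume "g \<in> induced ?K U" "h \<in> induced ?K U" and c: "card g = 2" "card h = 2"
      and dis: "g \<inter> h = {}"
    then have gh: "g \<in> ?K" "h \<in> ?K" "g \<union> h \<subseteq> U" by (auto simp: induced_def)
    have "g \<noteq> h" using dis c by auto
    \<comment> \<open>Here \<open>g\<close> and \<open>h\<close> are \<open>e\<close> and
      \<open>f\<close> in some order, so \<open>U\<close> contains every vertex, against its
      properness.\<close>
    with edge gh c have "g \<union> h = e \<union> f" by blast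
    with gh U show "\<exists>i\<in>induced ?K U. card i = 2 \<and> i \<inter> g \<noteq> {} \<and> i \<inter> h \<noteq> {}" by blast
  qed
  then show "shellability_obstruction (e \<union> f) ?K"
    using K not_shellable_disjoint_edges[OF e f disj] by (auto simp: shellability_obstruction_def)
  have "finite ?K" using fin by (simp add: complex_with_facets_def)
  moreover have "1 \<in> face_dim ` ?K"
    using e by (intro image_eqI[of _ _ e]) (auto simp: face_dim_def complex_with_facets_def)
  ultimately show "complex_dim ?K = 1"
    unfolding complex_dim_def by (intro Max_eqI) (auto simp: face_dim_def dest: le)
qed

section \<open>Uniqueness up to isomorphism\<close>

lemma one_dim_obstruction_is_two_disjoint_edges:
  assumes obs: "shellability_obstruction V K" and dim: "complex_dim K = 1"
  obtains e f where "card e = 2" "card f = 2" "e \<inter> f = {}" "V = e \<union> f"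
    "K = complex_with_facets {e, f}"
proof -
  have K: "simplicial_complex V K" and nsh: "\<not> shellable K"
    and sh: "\<And>U. U \<subset> V \<Longrightarrow> shellable (induced K U)"
    using obs by (auto simp: shellability_obstruction_def)
  have KV: "K \<subseteq> Pow V" and finV: "finite V"
    and down: "\<And>F G. F \<in> K \<Longrightarrow> G \<subseteq> F \<Longrightarrow> G \<in> K"
    using K by (auto simp: simplicial_complex_def)
  have finK: "finite K" using KV finV finite_subset by auto
  have le: "card F \<le> 2" if "F \<in> K" for F
  proof -
    have "face_dim F \<le> complex_dim K"
      using finK that by (simp add: complex_dim_def)
    with dim show ?thesis by (simp add: face_dim_def)
  qed
  \<comment> \<open>If every pair of disjoint edges were joined by an edge, \<open>K\<close> would
    be shellable.\<close>
  obtain e f where ef: "e \<in> K" "f \<in> K" "card e = 2" "card f = 2" "e \<inter> f = {}"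
    and unjoined: "\<And>g. g \<in> K \<Longrightarrow> card g = 2 \<Longrightarrow> g \<inter> e = {} \<or> g \<inter> f = {}"
  proof (rule ccontr, goal_cases)
    case 1
    note ex = 1(1)
    have "\<exists>g\<in>K. card g = 2 \<and> g \<inter> e \<noteq> {} \<and> g \<inter> f \<noteq> {}"
      if "e \<in> K" "f \<in> K" "card e = 2" "card f = 2" "e \<inter> f = {}" for e f
      using 1(2) ex[OF that] by blast
    from shellable_if_edges_joined[OF K le this] nsh show False by blast
  qed
  have ind: "induced K (e \<union> f) = complex_with_facets {e, f}"
  proof
    show "complex_with_facets {e, f} \<subseteq> induced K (e \<union> f)"
      using ef down by (auto simp: induced_def complex_with_facets_def)
    show "induced K (e \<union> f) \<subseteq> complex_with_facets {e, f}"
    proof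
      fix F assume F: "F \<in> induced K (e \<union> f)"
      then have FK: "F \<in> K" and sub: "F \<subseteq> e \<union> f" by (auto simp: induced_def)
      have "F \<subseteq> e \<or> F \<subseteq> f"
      proof (rule ccontr)
        assume "\<not> (F \<subseteq> e \<or> F \<subseteq> f)"
        \<comment> \<open>A face contained in neither edge has a vertex in each. These two vertices
          span an edge of \<open>K\<close> that joins \<open>e\<close> to \<open>f\<close>, which
          \<open>unjoined\<close> forbids.\<close>
        with sub obtain x y where xy: "x \<in> F" "x \<in> e" "y \<in> F" "y \<in> f" by blast
        with ef(5) have "x \<noteq> y" by blast
        moreover have "{x, y} \<in> K" using xy by (intro down[OF FK]) simp
        ultimately have "{x, y} \<inter> e = {} \<or> {x, y} \<inter> f = {}" by (intro unjoined) simp_all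
        with xy show False by blast
      qed
      then show "F \<in> complex_with_facets {e, f}" by (auto simp: complex_with_facets_def)
    qed
  qed
  \<comment> \<open>Minimality of the obstruction: the subcomplex induced on
    \<open>e \<union> f\<close> is nonshellable, so it cannot be proper.\<close>
  have V: "e \<union> f = V"
  proof (rule ccontr)
    assume "e \<union> f \<noteq> V"
    moreover have "e \<union> f \<subseteq> V" using ef(1,2) KV by blast
    ultimately have "shellable (induced K (e \<union> f))" by (intro sh) blast
    then show False using ind not_shellable_disjoint_edges[OF ef(3-5)] by simp
  qed
  moreover have "induced K V = K" using KV by (auto simp: induced_def)
  ultimately have "K = complex_with_facets {e, f}" using ind by simp
  with V show thesis using that[OF ef(3-5)] by simp
qed

text \<open>Bijections between corresponding edges glue to one of the vertex sets, as the edges are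
  disjoint on both sides. Faces are exactly the subsets of one of the edges, so matching the edges
  matches all faces.\<close>

lemma complex_iso_two_disjoint_edges:
  assumes "card e = 2" "card f = 2" "e \<inter> f = {}"
    and "card e' = 2" "card f' = 2" "e' \<inter> f' = {}"
  shows "complex_iso (e \<union> f) (complex_with_facets {e, f})
           (e' \<union> f') (complex_with_facets {e', f'})"
proof -
  have fin: "finite e" "finite f" "finite e'" "finite f'"
    using assms card.infinite by fastforce+
  obtain g where g: "bij_betw g e e'" using fin assms finite_same_card_bij by metis
  obtain h where h: "bij_betw h f f'" using fin assms finite_same_card_bij by metis
  define j where "j x = (if x \<in> e then g x else h x)" for x
  have je: "bij_betw j e e'" using g by (simp add: j_def cong: bij_betw_cong)
  have "\<And>x. x \<in> f \<Longrightarrow> j x = h x" using assms(3) by (auto simp: j_def)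
  then have jf: "bij_betw j f f'" using h by (simp cong: bij_betw_cong)
  have j: "bij_betw j (e \<union> f) (e' \<union> f')"
    using je jf assms(6) by (rule bij_betw_combine)
  have "j ` F \<subseteq> e' \<longleftrightarrow> F \<subseteq> e" "j ` F \<subseteq> f' \<longleftrightarrow> F \<subseteq> f" if "F \<subseteq> e \<union> f" for F
  proof -
    \<comment> \<open>Injectivity of \<open>j\<close> on all vertices makes it reflect inclusions;
      the cases \<open>G = e\<close> and \<open>G = f\<close> are the ones used.\<close>
    have "j ` F \<subseteq> j ` G \<longleftrightarrow> F \<subseteq> G" if "G \<subseteq> e \<union> f" for G
      using inj_on_image_mem_iff[OF bij_betw_imp_inj_on[OF j] _ that] \<open>F \<subseteq> e \<union> f\<close>
      unfolding image_subset_iff by blast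
    from this[of e] this[of f] show "j ` F \<subseteq> e' \<longleftrightarrow> F \<subseteq> e" "j ` F \<subseteq> f' \<longleftrightarrow> F \<subseteq> f"
      by (simp_all add: bij_betw_imp_surj_on[OF je] bij_betw_imp_surj_on[OF jf])
  qed
  with j show ?thesis
    unfolding complex_iso_def complex_with_facets_def by (intro exI[of _ j]) auto
qed

theorem proposition2:
  fixes a b c d :: 'b
  assumes "distinct [a, b, c, d]"
  shows "(shellability_obstruction {a, b, c, d} (complex_with_facets {{a, b}, {c, d}}) \<and>
          complex_dim (complex_with_facets {{a, b}, {c, d}}) = 1) \<and>
         (\<forall>(V :: 'a set) K.
            shellability_obstruction V K \<and> complex_dim K = 1 \<longrightarrow>
            complex_iso V K {a, b, c, d} (complex_with_facets {{a, b}, {c, d}}))"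
proof -
  have edges: "card {a, b} = 2" "card {c, d} = 2" "{a, b} \<inter> {c, d} = {}"
    using assms by auto
  \<comment> \<open>The lemmas speak of a union of two edges. The simplifier would merge this union
    back into one enumerated set, hence the deleted \<open>Un_insert\<close> rules below.\<close>
  have vertices: "{a, b, c, d} = {a, b} \<union> {c, d}" by auto
  show ?thesis
    unfolding vertices
    using obstruction_two_disjoint_edges[OF edges]
    by (auto elim!: one_dim_obstruction_is_two_disjoint_edges
        simp del: Un_insert_left Un_insert_right intro: complex_iso_two_disjoint_edges edges)
qed

end
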